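(* Let $\mathcal{A}=(L,E,R,\partial_1,\partial_2,\{,\})$ and $\mathcal{A}'=(L',E',R',\partial_1',\partial_2',\{,\})$ be 2-crossed modules of commutative algebras, where $\mathcal{A}$ is free up to order one. Then the relation on the set of 2-crossed module maps $\mathcal{A}\to\mathcal{A}'$ given by $$f\simeq g\iff\text{there exists a quadratic } f\text{-derivation }(s,t)\text{ connecting } f\text{ with } g$$ is an equivalence relation.
   Context: Conventions. $\kappa$ is a fixed commutative ring. All algebras are commutative associative $\kappa$-algebras, not assumed unital; algebra maps are $\kappa$-linear multiplicative maps. An action of an algebra $R$ on an algebra $M$ is a $\kappa$-bilinear map $(r,m)\mapsto r\blacktriangleright m\in M$ with $r\blacktriangleright(mm')=(r\blacktriangleright m)m'=m(r\blacktriangleright m')$ and $(rr')\blacktriangleright m=r\blacktriangleright(r'\blacktriangleright m)$. 2-crossed modules. A 2-crossed module $(L,E,R,\partial_1,\partial_2,\{,\})$ consists of algebra maps $L\xrightarrow{\partial_2}E\xrightarrow{\partial_1}R$ with $\partial_1\partial_2=0$, actions $\blacktriangleright$ of $R$ on $E$ and on $L$ with $\partial_1(r\blacktriangleright e)=r\,\partial_1(e)$ and $\partial_2(r\blacktriangleright l)=r\blacktriangleright\partial_2(l)$, and an $R$-bilinear Peiffer lifting $\{\,\otimes\,\}\colon E\otimes_R E\to L$ such that, writing $e\blacktriangleright' l:=\{e\otimes\partial_2(l)\}$ (this is an action of $E$ on $L$), for all $e,e',e''\in E$, $l,l'\in L$, $r\in R$: $\partial_2\{e\otimes e'\}=ee'-\partial_1(e')\blacktriangleright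 e$; $\{\partial_2(l)\otimes\partial_2(l')\}=ll'$; $\{e\otimes e'e''\}=\{ee'\otimes e''\}+\partial_1(e'')\blacktriangleright\{e\otimes e'\}$; $\{\partial_2(l)\otimes e\}=e\blacktriangleright' l-\partial_1(e)\blacktriangleright l$; $r\blacktriangleright\{e\otimes e'\}=\{r\blacktriangleright e\otimes e'\}=\{e\otimes r\blacktriangleright e'\}$. It is free up to order one if $R$ is the free commutative $\kappa$-algebra on some subset $B\subset R$, i.e. every set map from $B$ to an algebra extends uniquely to an algebra map from $R$. Maps. A 2-crossed module map $f=(f_2,f_1,f_0)\colon\mathcal{A}\to\mathcal{A}'$ consists of algebra maps $f_2\colon L\to L'$, $f_1\colon E\to E'$, $f_0\colon R\to R'$ with $\partial_2'f_2=f_1\partial_2$, $\partial_1'f_1=f_0\partial_1$, $f_1(r\blacktriangleright e)=f_0(r)\blacktriangleright f_1(e)$, $f_2(r\blacktriangleright l)=f_0(r)\blacktriangleright f_2(l)$, $f_2\{e\otimes e'\}=\{f_1(e)\otimes f_1(e')\}$. Quadratic derivations. A quadratic $f$-derivation is a pair $(s,t)$ of $\kappa$-linear maps $s\colon R\to E'$, $t\colon E\to L'$ such that for all $r,r'\in R$, $e,e'\in E$: $s(rr')=f_0(r)\blacktriangleright s(r')+f_0(r')\blacktriangleright s(r)+s(r)s(r')$, $t(ee')=\{s\partial_1(e)\otimes f_1(e')\}+\{s\partial_1(e')\otimes f_1(e)\}+f_1(e)\blacktriangleright' t(e')+f_1(e')\blacktriangleright' t(e)+s\partial_1(e)\blacktriangleright'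 t(e')+s\partial_1(e')\blacktriangleright' t(e)+t(e)t(e')$, $t(r\blacktriangleright e)=f_0(r)\blacktriangleright t(e)+\partial_1's(r)\blacktriangleright t(e)+\{s(r)\otimes f_1(e)\}-\{f_1(e)\otimes s(r)\}-\{s\partial_1(e)\otimes s(r)\}$. It connects $f$ to $g$ if $g_0=f_0+\partial_1's$, $g_1=f_1+s\partial_1+\partial_2't$, $g_2=f_2+t\partial_2$. *)

theory Defs
  imports Main
begin

section \<open>Commutative, not necessarily unital algebras over a commutative ring\<close>

text \<open>
  The ground ring is a type of sort \<open>{comm_ring, comm_monoid_mult}\<close>, that is, a commutative ring
  with unit. The class \<open>comm_ring_1\<close>, on which the library locale \<open>module\<close> is built, would in
  addition require \<open>0 \<noteq> 1\<close>. The class \<open>comm_ring\<close> of the algebras themselves does not provide a unit.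
\<close>

locale comm_algebra =
  fixes scale :: "'k::{comm_ring,comm_monoid_mult} \<Rightarrow> 'a::comm_ring \<Rightarrow> 'a"
  assumes scale_right_distrib: "scale a (x + y) = scale a x + scale a y"
    and scale_left_distrib: "scale (a + b) x = scale a x + scale b x"
    and scale_scale: "scale a (scale b x) = scale (a * b) x"
    and scale_one: "scale 1 x = x"
    and scale_mult: "scale a (x * y) = scale a x * y"

definition klinear ::
  "('k \<Rightarrow> 'a::comm_ring \<Rightarrow> 'a) \<Rightarrow> ('k \<Rightarrow> 'b::comm_ring \<Rightarrow> 'b) \<Rightarrow> ('a \<Rightarrow> 'b) \<Rightarrow> bool" where
  "klinear sA sB \<phi> \<longleftrightarrow>
     (\<forall>x y. \<phi> (x + y) = \<phi> x + \<phi> y) \<and> (\<forall>a x. \<phi> (sA a x) = sB a (\<phi> x))"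

definition kbilinear ::
  "('k \<Rightarrow> 'a::comm_ring \<Rightarrow> 'a) \<Rightarrow> ('k \<Rightarrow> 'b::comm_ring \<Rightarrow> 'b) \<Rightarrow>
   ('k \<Rightarrow> 'c::comm_ring \<Rightarrow> 'c) \<Rightarrow> ('a \<Rightarrow> 'b \<Rightarrow> 'c) \<Rightarrow> bool" where
  "kbilinear sA sB sC \<beta> \<longleftrightarrow>
     (\<forall>x. klinear sB sC (\<beta> x)) \<and> (\<forall>y. klinear sA sC (\<lambda>x. \<beta> x y))"

definition algebra_map ::
  "('k \<Rightarrow> 'a::comm_ring \<Rightarrow> 'a) \<Rightarrow> ('k \<Rightarrow> 'b::comm_ring \<Rightarrow> 'b) \<Rightarrow> ('a \<Rightarrow> 'b) \<Rightarrow> bool" where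
  "algebra_map sA sB \<phi> \<longleftrightarrow> klinear sA sB \<phi> \<and> (\<forall>x y. \<phi> (x * y) = \<phi> x * \<phi> y)"

definition algebra_action ::
  "('k \<Rightarrow> 'r::comm_ring \<Rightarrow> 'r) \<Rightarrow> ('k \<Rightarrow> 'm::comm_ring \<Rightarrow> 'm) \<Rightarrow> ('r \<Rightarrow> 'm \<Rightarrow> 'm) \<Rightarrow> bool" where
  "algebra_action sR sM act \<longleftrightarrow>
     kbilinear sR sM sM act \<and>
     (\<forall>r m m'. act r (m * m') = act r m * m') \<and>
     (\<forall>r m m'. act r (m * m') = m * act r m') \<and>
     (\<forall>r r' m. act (r * r') m = act r (act r' m))"


section \<open>Free commutative algebras\<close>

text \<open>
  Freeness of an algebra is a universal property with respect to all algebras. HOL cannot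
  quantify over types inside a formula, so the property is first stated for the algebras whose
  carrier is a subset of a given type \<open>'u\<close>, and then used for a type \<open>'u\<close> that is large enough
  for the property to hold with respect to the algebras over every type
  (theorem \<open>free_algebra_on_universal\<close> below).
\<close>

record ('k, 'u) alg_struct =
  carr :: "'u set"
  add :: "'u \<Rightarrow> 'u \<Rightarrow> 'u"
  zero :: 'u
  neg :: "'u \<Rightarrow> 'u"
  mult :: "'u \<Rightarrow> 'u \<Rightarrow> 'u"
  smul :: "'k \<Rightarrow> 'u \<Rightarrow> 'u"

locale comm_algebra_on =
  fixes X :: "('k::{comm_ring,comm_monoid_mult}, 'u) alg_struct"
  assumes add_closed: "x \<in> carr X \<Longrightarrow> y \<in> carr X \<Longrightarrow> add X x y \<in> carr X"
    and zero_closed: "zero X \<in> carr X"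
    and neg_closed: "x \<in> carr X \<Longrightarrow> neg X x \<in> carr X"
    and mult_closed: "x \<in> carr X \<Longrightarrow> y \<in> carr X \<Longrightarrow> mult X x y \<in> carr X"
    and smul_closed: "x \<in> carr X \<Longrightarrow> smul X a x \<in> carr X"
    and add_assoc: "x \<in> carr X \<Longrightarrow> y \<in> carr X \<Longrightarrow> z \<in> carr X \<Longrightarrow>
      add X (add X x y) z = add X x (add X y z)"
    and add_commute: "x \<in> carr X \<Longrightarrow> y \<in> carr X \<Longrightarrow> add X x y = add X y x"
    and add_zero: "x \<in> carr X \<Longrightarrow> add X (zero X) x = x"
    and add_neg: "x \<in> carr X \<Longrightarrow> add X (neg X x) x = zero X"
    and mult_assoc: "x \<in> carr X \<Longrightarrow> y \<in> carr X \<Longrightarrow> z \<in> carr X \<Longrightarrow>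
      mult X (mult X x y) z = mult X x (mult X y z)"
    and mult_commute: "x \<in> carr X \<Longrightarrow> y \<in> carr X \<Longrightarrow> mult X x y = mult X y x"
    and distrib: "x \<in> carr X \<Longrightarrow> y \<in> carr X \<Longrightarrow> z \<in> carr X \<Longrightarrow>
      mult X (add X x y) z = add X (mult X x z) (mult X y z)"
    and smul_add_right: "x \<in> carr X \<Longrightarrow> y \<in> carr X \<Longrightarrow>
      smul X a (add X x y) = add X (smul X a x) (smul X a y)"
    and smul_add_left: "x \<in> carr X \<Longrightarrow>
      smul X (a + b) x = add X (smul X a x) (smul X b x)"
    and smul_smul: "x \<in> carr X \<Longrightarrow> smul X a (smul X b x) = smul X (a * b) x"
    and smul_one: "x \<in> carr X \<Longrightarrow> smul X 1 x = x"
    and smul_mult: "x \<in> carr X \<Longrightarrow> y \<in> carr X \<Longrightarrow>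
      smul X a (mult X x y) = mult X (smul X a x) y"

definition type_algebra :: "('k \<Rightarrow> 'a::comm_ring \<Rightarrow> 'a) \<Rightarrow> ('k, 'a) alg_struct" where
  "type_algebra scale =
     \<lparr>carr = UNIV, add = (+), zero = 0, neg = uminus, mult = (*), smul = scale\<rparr>"

lemma comm_algebra_on_type_algebra:
  "comm_algebra_on (type_algebra scale) \<longleftrightarrow> comm_algebra scale"
  unfolding comm_algebra_on_def comm_algebra_def type_algebra_def
  by (simp add: algebra_simps) blast

definition algebra_map_into ::
  "('k \<Rightarrow> 'r::comm_ring \<Rightarrow> 'r) \<Rightarrow> ('k, 'u) alg_struct \<Rightarrow> ('r \<Rightarrow> 'u) \<Rightarrow> bool" where
  "algebra_map_into sR X \<phi> \<longleftrightarrow>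
     (\<forall>x. \<phi> x \<in> carr X) \<and>
     (\<forall>x y. \<phi> (x + y) = add X (\<phi> x) (\<phi> y)) \<and>
     (\<forall>a x. \<phi> (sR a x) = smul X a (\<phi> x)) \<and>
     (\<forall>x y. \<phi> (x * y) = mult X (\<phi> x) (\<phi> y))"

lemma algebra_map_into_type_algebra:
  "algebra_map_into sA (type_algebra sB) \<phi> \<longleftrightarrow> algebra_map sA sB \<phi>"
  by (auto simp: algebra_map_into_def algebra_map_def klinear_def type_algebra_def)

definition free_wrt ::
  "'u itself \<Rightarrow> ('k::{comm_ring,comm_monoid_mult} \<Rightarrow> 'r::comm_ring \<Rightarrow> 'r) \<Rightarrow> 'r set \<Rightarrow> bool" where
  "free_wrt TYPE('u) sR B \<longleftrightarrow>
     (\<forall>(X :: ('k, 'u) alg_struct) h. comm_algebra_on X \<longrightarrow> h ` B \<subseteq> carr X \<longrightarrow>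
        (\<exists>!\<phi>. algebra_map_into sR X \<phi> \<and> (\<forall>b\<in>B. \<phi> b = h b)))"

text \<open>
  The large enough type is the type of formal algebra expressions over \<open>'r\<close>: each algebra generated
  by the image of a map from a subset of \<open>'r\<close> is a quotient of it, and hence isomorphic to an algebra
  carried by a set of representatives.
\<close>

datatype ('r, 'k) alg_term =
    Gen 'r
  | Zero
  | Neg "('r, 'k) alg_term"
  | Add "('r, 'k) alg_term" "('r, 'k) alg_term"
  | Mult "('r, 'k) alg_term" "('r, 'k) alg_term"
  | Smul 'k "('r, 'k) alg_term"

definition free_algebra_on ::
  "('k::{comm_ring,comm_monoid_mult} \<Rightarrow> 'r::comm_ring \<Rightarrow> 'r) \<Rightarrow> 'r set \<Rightarrow> bool" where
  "free_algebra_on sR B \<longleftrightarrow> free_wrt TYPE(('r, 'k) alg_term) sR B"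

primrec eval_term :: "('k, 'u) alg_struct \<Rightarrow> ('r \<Rightarrow> 'u) \<Rightarrow> ('r, 'k) alg_term \<Rightarrow> 'u" where
  "eval_term X h (Gen r) = h r"
| "eval_term X h Zero = zero X"
| "eval_term X h (Neg p) = neg X (eval_term X h p)"
| "eval_term X h (Add p q) = add X (eval_term X h p) (eval_term X h q)"
| "eval_term X h (Mult p q) = mult X (eval_term X h p) (eval_term X h q)"
| "eval_term X h (Smul a p) = smul X a (eval_term X h p)"

definition repr_algebra ::
  "('k, 'u) alg_struct \<Rightarrow> ('r \<Rightarrow> 'u) \<Rightarrow> ('k, ('r, 'k) alg_term) alg_struct" where
  "repr_algebra X h = (let e = eval_term X h; i = inv e in
     \<lparr>carr = i ` range e, add = (\<lambda>p q. i (add X (e p) (e q))), zero = i (zero X),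
      neg = (\<lambda>p. i (neg X (e p))), mult = (\<lambda>p q. i (mult X (e p) (e q))),
      smul = (\<lambda>a p. i (smul X a (e p)))\<rparr>)"

context comm_algebra_on
begin

lemma eval_term_closed: "range h \<subseteq> carr X \<Longrightarrow> eval_term X h p \<in> carr X"
  by (induction p)
    (auto intro: add_closed zero_closed neg_closed mult_closed smul_closed)

lemma eval_inv_simps:
  fixes h :: "'r \<Rightarrow> 'u"
  defines "e \<equiv> eval_term X h"
  shows "e (inv e (e p)) = e p" "e (inv e (zero X)) = zero X"
    "e (inv e (neg X (e p))) = neg X (e p)"
    "e (inv e (add X (e p) (e q))) = add X (e p) (e q)"
    "e (inv e (mult X (e p) (e q))) = mult X (e p) (e q)"
    "e (inv e (smul X a (e p))) = smul X a (e p)"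
proof -
  have *: "e (inv e (e p)) = e p" for p
    by (simp add: f_inv_into_f)
  show "e (inv e (e p)) = e p" by (rule *)
  show "e (inv e (zero X)) = zero X" using *[of Zero] by (simp add: e_def)
  show "e (inv e (neg X (e p))) = neg X (e p)" using *[of "Neg p"] by (simp add: e_def)
  show "e (inv e (add X (e p) (e q))) = add X (e p) (e q)"
    using *[of "Add p q"] by (simp add: e_def)
  show "e (inv e (mult X (e p) (e q))) = mult X (e p) (e q)"
    using *[of "Mult p q"] by (simp add: e_def)
  show "e (inv e (smul X a (e p))) = smul X a (e p)"
    using *[of "Smul a p"] by (simp add: e_def)
qed

lemma comm_algebra_on_repr:
  fixes h :: "'r \<Rightarrow> 'u"
  assumes h: "range h \<subseteq> carr X"
  shows "comm_algebra_on (repr_algebra X h)"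
proof -
  define e where "e = eval_term X h"
  define i where "i = inv e"
  note S = eval_inv_simps[of h, folded e_def, folded i_def]
  have cl: "e p \<in> carr X" for p
    using eval_term_closed[OF h] by (simp add: e_def)
  have Y: "repr_algebra X h =
     \<lparr>carr = i ` range e, add = (\<lambda>p q. i (add X (e p) (e q))), zero = i (zero X),
      neg = (\<lambda>p. i (neg X (e p))), mult = (\<lambda>p q. i (mult X (e p) (e q))),
      smul = (\<lambda>a p. i (smul X a (e p)))\<rparr>"
    by (simp add: repr_algebra_def e_def i_def Let_def)
  have ie: "i (e x) = x" if "x \<in> i ` range e" for x
    using that S(1) by auto
  have mem: "i (zero X) \<in> i ` range e" "i (neg X (e p)) \<in> i ` range e"
    "i (add X (e p) (e q)) \<in> i ` range e" "i (mult X (e p) (e q)) \<in> i ` range e"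
    "i (smul X a (e p)) \<in> i ` range e" for p q a
    using S(2-) by (metis image_eqI rangeI)+
  show ?thesis
    unfolding comm_algebra_on_def Y alg_struct.simps
    by (intro conjI allI impI mem;
        (simp only: S ie cl add_zero add_neg smul_one smul_add_left
           smul_smul)?;
        (rule arg_cong[where f = i])?;
        (rule add_assoc add_commute add_zero mult_assoc mult_commute distrib smul_add_right
           smul_mult)?;
        (rule cl)?)
qed

lemma map_of_repr:
  fixes h :: "'r::comm_ring \<Rightarrow> 'u"
  assumes h: "range h \<subseteq> carr X"
    and \<phi>: "algebra_map_into sR (repr_algebra X h) \<phi>"
  shows "algebra_map_into sR X (\<lambda>r. eval_term X h (\<phi> r))"
  using \<phi> eval_term_closed[OF h] eval_inv_simps[of h]
  by (auto simp: algebra_map_into_def repr_algebra_def Let_def)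

lemma map_to_repr:
  fixes h :: "'r::comm_ring \<Rightarrow> 'u"
  assumes \<phi>: "algebra_map_into sR X \<phi>" and r: "range \<phi> \<subseteq> range (eval_term X h)"
  shows "algebra_map_into sR (repr_algebra X h) (\<lambda>r. inv (eval_term X h) (\<phi> r))"
proof -
  have "eval_term X h (inv (eval_term X h) (\<phi> r)) = \<phi> r" for r
    using r by (intro f_inv_into_f) auto
  then show ?thesis
    using \<phi> r by (auto simp: algebra_map_into_def repr_algebra_def Let_def intro!: imageI)
qed

lemma add_left_eq_self:
  assumes "x \<in> carr X" "y \<in> carr X" "add X y x = x"
  shows "y = zero X"
  by (metis add_assoc add_commute add_neg add_zero assms neg_closed)

lemma map_zero:
  assumes "algebra_map_into sR X \<phi>"
  shows "\<phi> 0 = zero X"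
proof (rule add_left_eq_self)
  show "add X (\<phi> 0) (\<phi> 0) = \<phi> 0"
    using assms unfolding algebra_map_into_def by (metis add_0)
qed (use assms in \<open>auto simp: algebra_map_into_def\<close>)

lemma map_neg:
  assumes "algebra_map_into sR X \<phi>"
  shows "\<phi> (- x) = neg X (\<phi> x)"
proof -
  have c: "\<phi> y \<in> carr X" for y
    using assms by (simp add: algebra_map_into_def)
  have z: "add X (\<phi> (- x)) (\<phi> x) = zero X"
    using assms map_zero[OF assms] unfolding algebra_map_into_def by (metis ab_left_minus)
  have n: "add X (\<phi> x) (neg X (\<phi> x)) = zero X"
    using add_commute add_neg c neg_closed by metis
  have "\<phi> (- x) = add X (zero X) (\<phi> (- x))"
    by (simp add: add_zero c)
  also have "\<dots> = add X (\<phi> (- x)) (add X (\<phi> x) (neg X (\<phi> x)))"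
    by (simp add: n add_commute c zero_closed)
  also have "\<dots> = add X (add X (\<phi> (- x)) (\<phi> x)) (neg X (\<phi> x))"
    by (simp add: add_assoc c neg_closed)
  also have "\<dots> = neg X (\<phi> x)"
    by (simp add: z add_zero c neg_closed)
  finally show ?thesis .
qed

lemma map_eval_term:
  assumes "algebra_map_into sR X \<phi>"
  shows "\<phi> (eval_term (type_algebra sR) g p) = eval_term X (\<phi> \<circ> g) p"
proof (induction p)
  case Zero
  then show ?case using map_zero[OF assms] by (simp add: type_algebra_def)
next
  case (Neg p)
  then show ?case using map_neg[OF assms] by (simp add: type_algebra_def)
qed (use assms in \<open>simp_all add: algebra_map_into_def type_algebra_def\<close>)

end

lemma free_wrt_exists:
  fixes sR :: "'k::{comm_ring,comm_monoid_mult} \<Rightarrow> 'r::comm_ring \<Rightarrow> 'r"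
  assumes free: "free_algebra_on sR B" and X: "comm_algebra_on X" and h: "range h \<subseteq> carr X"
  shows "\<exists>\<phi>. algebra_map_into sR X \<phi> \<and> (\<forall>b\<in>B. \<phi> b = h b) \<and> range \<phi> \<subseteq> range (eval_term X h)"
proof -
  interpret comm_algebra_on X by (rule X)
  define e where "e = eval_term X h"
  have "(\<lambda>b. inv e (h b)) ` B \<subseteq> carr (repr_algebra X h)"
    unfolding repr_algebra_def Let_def e_def by (auto intro!: imageI range_eqI[of _ _ "Gen b" for b])
  with free comm_algebra_on_repr[OF h] obtain \<phi>
    where \<phi>: "algebra_map_into sR (repr_algebra X h) \<phi>" and b: "\<forall>b\<in>B. \<phi> b = inv e (h b)"
    unfolding free_algebra_on_def free_wrt_def by blast
  have "e (inv e (h b)) = h b" for b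
    using eval_inv_simps(1)[of h "Gen b"] by (simp add: e_def)
  with map_of_repr[OF h \<phi>] b show ?thesis
    by (intro exI[of _ "\<lambda>r. eval_term X h (\<phi> r)"]) (auto simp: e_def)
qed

theorem free_algebra_on_universal:
  fixes sR :: "'k::{comm_ring,comm_monoid_mult} \<Rightarrow> 'r::comm_ring \<Rightarrow> 'r"
  assumes R: "comm_algebra sR" and free: "free_algebra_on sR B"
  shows "free_wrt TYPE('u) sR B"
proof -
  let ?T = "type_algebra sR"
  interpret T: comm_algebra_on ?T
    using R by (simp add: comm_algebra_on_type_algebra)
  have uniq: "\<phi> = id" if \<phi>: "algebra_map_into sR ?T \<phi>" and b: "\<forall>b\<in>B. \<phi> b = b" for \<phi>
  proof -
    let ?e = "eval_term ?T (\<lambda>r. r)" and ?Y = "repr_algebra ?T (\<lambda>r. r)"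
    have rng: "range ?e = UNIV"
      by (metis eval_term.simps(1) surjI)
    have Y: "comm_algebra_on ?Y"
      by (rule T.comm_algebra_on_repr) (simp add: type_algebra_def)
    have m: "algebra_map_into sR ?Y (\<lambda>r. inv ?e (\<psi> r))"
      if "algebra_map_into sR ?T \<psi>" for \<psi>
      by (rule T.map_to_repr[OF that]) (simp add: rng)
    have "algebra_map_into sR ?T id"
      by (simp add: algebra_map_into_type_algebra algebra_map_def klinear_def)
    from m[OF this] have 1: "algebra_map_into sR ?Y (\<lambda>r. inv ?e r)" by simp
    have "inv ?e ` B \<subseteq> carr ?Y"
      by (auto simp: repr_algebra_def Let_def rng)
    with free Y 1 m[OF \<phi>] b have "(\<lambda>r. inv ?e (\<phi> r)) = (\<lambda>r. inv ?e r)"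
      unfolding free_algebra_on_def free_wrt_def by (smt (verit, best))
    then have "inv ?e (\<phi> r) = inv ?e r" for r by meson
    then have "\<phi> r = r" for r
      by (metis rng surj_f_inv_f)
    then show ?thesis by auto
  qed
  let ?g = "\<lambda>r. if r \<in> B then r else 0"
  have gen: "\<exists>p. r = eval_term ?T ?g p" for r
  proof -
    obtain \<phi> where "algebra_map_into sR ?T \<phi>" "\<forall>b\<in>B. \<phi> b = ?g b"
      and *: "range \<phi> \<subseteq> range (eval_term ?T ?g)"
      using free_wrt_exists[OF free T.comm_algebra_on_axioms, of ?g]
      by (auto simp: type_algebra_def)
    then have "\<phi> = id" by (intro uniq) auto
    with * show ?thesis by auto
  qed
  show ?thesis
    unfolding free_wrt_def
  proof (intro allI impI)
    fix X :: "('k, 'u) alg_struct" and h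
    assume X: "comm_algebra_on X" and h: "h ` B \<subseteq> carr X"
    interpret comm_algebra_on X by (rule X)
    have "range (\<lambda>r. if r \<in> B then h r else zero X) \<subseteq> carr X"
      using h zero_closed by auto
    from free_wrt_exists[OF free X this] obtain \<phi>
      where \<phi>: "algebra_map_into sR X \<phi>" "\<forall>b\<in>B. \<phi> b = h b" by auto
    show "\<exists>!\<phi>. algebra_map_into sR X \<phi> \<and> (\<forall>b\<in>B. \<phi> b = h b)"
    proof (rule ex1I)
      show "algebra_map_into sR X \<phi> \<and> (\<forall>b\<in>B. \<phi> b = h b)" using \<phi> by blast
      fix \<psi> assume \<psi>: "algebra_map_into sR X \<psi> \<and> (\<forall>b\<in>B. \<psi> b = h b)"
      have "\<psi> \<circ> ?g = \<phi> \<circ> ?g"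
        using \<phi> \<psi> map_zero[of sR \<phi>] map_zero[of sR \<psi>] by (auto simp: fun_eq_iff)
      then have "\<psi> (eval_term ?T ?g p) = \<phi> (eval_term ?T ?g p)" for p
        using \<psi> by (simp add: map_eval_term[of sR \<psi>] map_eval_term[OF \<phi>(1)])
      then show "\<psi> = \<phi>"
        using gen by (metis (no_types, lifting) ext)
    qed
  qed
qed


section \<open>2-crossed modules\<close>

record ('k, 'l, 'e, 'r) two_xmod =
  scaleL :: "'k \<Rightarrow> 'l \<Rightarrow> 'l"
  scaleE :: "'k \<Rightarrow> 'e \<Rightarrow> 'e"
  scaleR :: "'k \<Rightarrow> 'r \<Rightarrow> 'r"
  bd1 :: "'e \<Rightarrow> 'r"
  bd2 :: "'l \<Rightarrow> 'e"
  actE :: "'r \<Rightarrow> 'e \<Rightarrow> 'e"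
  actL :: "'r \<Rightarrow> 'l \<Rightarrow> 'l"
  peiffer :: "'e \<Rightarrow> 'e \<Rightarrow> 'l"

definition actEL :: "('k, 'l, 'e, 'r) two_xmod \<Rightarrow> 'e \<Rightarrow> 'l \<Rightarrow> 'l" where
  "actEL A e l = peiffer A e (bd2 A l)"

text \<open>
  The Peiffer lifting, a map on the tensor product of \<open>E\<close> with itself over \<open>R\<close>, is represented by
  the corresponding bilinear map, which by \<open>peiffer_equivariant\<close> is balanced over \<open>R\<close> and
  \<open>R\<close>-linear in both arguments.
\<close>

locale two_crossed_module =
  fixes A ::
    "('k::{comm_ring,comm_monoid_mult}, 'l::comm_ring, 'e::comm_ring, 'r::comm_ring) two_xmod"
  assumes algebra_L: "comm_algebra (scaleL A)"
    and algebra_E: "comm_algebra (scaleE A)"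
    and algebra_R: "comm_algebra (scaleR A)"
    and bd2_map: "algebra_map (scaleL A) (scaleE A) (bd2 A)"
    and bd1_map: "algebra_map (scaleE A) (scaleR A) (bd1 A)"
    and bd1_bd2: "bd1 A (bd2 A l) = 0"
    and actE_action: "algebra_action (scaleR A) (scaleE A) (actE A)"
    and actL_action: "algebra_action (scaleR A) (scaleL A) (actL A)"
    and bd1_act: "bd1 A (actE A r e) = r * bd1 A e"
    and bd2_act: "bd2 A (actL A r l) = actE A r (bd2 A l)"
    and peiffer_bilinear: "kbilinear (scaleE A) (scaleE A) (scaleL A) (peiffer A)"
    and bd2_peiffer: "bd2 A (peiffer A e e') = e * e' - actE A (bd1 A e') e"
    and peiffer_bd2_bd2: "peiffer A (bd2 A l) (bd2 A l') = l * l'"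
    and peiffer_mult:
      "peiffer A e (e' * e'') = peiffer A (e * e') e'' + actL A (bd1 A e'') (peiffer A e e')"
    and peiffer_bd2_left: "peiffer A (bd2 A l) e = actEL A e l - actL A (bd1 A e) l"
    and peiffer_equivariant:
      "actL A r (peiffer A e e') = peiffer A (actE A r e) e'"
      "actL A r (peiffer A e e') = peiffer A e (actE A r e')"

lemma (in two_crossed_module) actEL_action:
  "algebra_action (scaleE A) (scaleL A) (actEL A)"
proof -
  have lin: "bd2 A (l + l') = bd2 A l + bd2 A l'" "bd2 A (scaleL A a l) = scaleE A a (bd2 A l)"
    "bd2 A (l * l') = bd2 A l * bd2 A l'" for l l' a
    using bd2_map by (auto simp: algebra_map_def klinear_def)
  have P: "klinear (scaleE A) (scaleL A) (peiffer A e)"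
    "klinear (scaleE A) (scaleL A) (\<lambda>e. peiffer A e e')" for e e'
    using peiffer_bilinear by (auto simp: kbilinear_def)
  have z: "actL A 0 l = 0" "actE A 0 e = 0" for l e
  proof -
    have "actL A (0 + 0) l = actL A 0 l + actL A 0 l" "actE A (0 + 0) e = actE A 0 e + actE A 0 e"
      using actL_action actE_action
      by (auto simp only: algebra_action_def kbilinear_def klinear_def)
    then show "actL A 0 l = 0" "actE A 0 e = 0" by simp_all
  qed
  have bd: "bd2 A (actEL A e l) = e * bd2 A l" for e l
    by (simp add: actEL_def bd2_peiffer bd1_bd2 z)
  have m: "peiffer A (e * e') (bd2 A l) = peiffer A e (e' * bd2 A l)" for e e' l
    by (simp add: peiffer_mult bd1_bd2 z)
  have r: "actEL A e (l * l') = actEL A e l * l'" for e l l'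
    by (metis actEL_def bd lin(3) m peiffer_bd2_bd2)
  have "kbilinear (scaleE A) (scaleL A) (scaleL A) (actEL A)"
    using P by (auto simp: kbilinear_def klinear_def actEL_def lin)
  moreover have "actEL A e (l * l') = l * actEL A e l'" for e l l'
    using r[of e l' l] by (simp add: mult.commute)
  moreover have "actEL A (e * e') l = actEL A e (actEL A e' l)" for e e' l
    by (metis actEL_def bd m)
  ultimately show ?thesis using r by (auto simp: algebra_action_def)
qed

definition free_up_to_order_one ::
  "('k::{comm_ring,comm_monoid_mult}, 'l, 'e, 'r::comm_ring) two_xmod \<Rightarrow> bool" where
  "free_up_to_order_one A \<longleftrightarrow> (\<exists>B. free_algebra_on (scaleR A) B)"


section \<open>Maps and quadratic derivations\<close>

text \<open>A map of 2-crossed modules is a triple \<open>(f\<^sub>2, f\<^sub>1, f\<^sub>0)\<close>.\<close>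

type_synonym ('l, 'e, 'r, 'l2, 'e2, 'r2) xmap = "('l \<Rightarrow> 'l2) \<times> ('e \<Rightarrow> 'e2) \<times> ('r \<Rightarrow> 'r2)"

definition two_xmod_maps ::
  "('k, 'l::comm_ring, 'e::comm_ring, 'r::comm_ring) two_xmod \<Rightarrow>
   ('k, 'l2::comm_ring, 'e2::comm_ring, 'r2::comm_ring) two_xmod \<Rightarrow>
   ('l, 'e, 'r, 'l2, 'e2, 'r2) xmap set" where
  "two_xmod_maps A A' = {(f2, f1, f0).
     algebra_map (scaleL A) (scaleL A') f2 \<and>
     algebra_map (scaleE A) (scaleE A') f1 \<and>
     algebra_map (scaleR A) (scaleR A') f0 \<and>
     (\<forall>l. bd2 A' (f2 l) = f1 (bd2 A l)) \<and>
     (\<forall>e. bd1 A' (f1 e) = f0 (bd1 A e)) \<and>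
     (\<forall>r e. f1 (actE A r e) = actE A' (f0 r) (f1 e)) \<and>
     (\<forall>r l. f2 (actL A r l) = actL A' (f0 r) (f2 l)) \<and>
     (\<forall>e e'. f2 (peiffer A e e') = peiffer A' (f1 e) (f1 e'))}"

definition quadratic_derivation ::
  "('k, 'l::comm_ring, 'e::comm_ring, 'r::comm_ring) two_xmod \<Rightarrow>
   ('k, 'l2::comm_ring, 'e2::comm_ring, 'r2::comm_ring) two_xmod \<Rightarrow>
   ('l, 'e, 'r, 'l2, 'e2, 'r2) xmap \<Rightarrow> ('r \<Rightarrow> 'e2) \<Rightarrow> ('e \<Rightarrow> 'l2) \<Rightarrow> bool" where
  "quadratic_derivation A A' f s t = (case f of (f2, f1, f0) \<Rightarrow>
     klinear (scaleR A) (scaleE A') s \<and>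
     klinear (scaleE A) (scaleL A') t \<and>
     (\<forall>r r'. s (r * r') = actE A' (f0 r) (s r') + actE A' (f0 r') (s r) + s r * s r') \<and>
     (\<forall>e e'. t (e * e') =
        peiffer A' (s (bd1 A e)) (f1 e') + peiffer A' (s (bd1 A e')) (f1 e)
        + actEL A' (f1 e) (t e') + actEL A' (f1 e') (t e)
        + actEL A' (s (bd1 A e)) (t e') + actEL A' (s (bd1 A e')) (t e)
        + t e * t e') \<and>
     (\<forall>r e. t (actE A r e) =
        actL A' (f0 r) (t e) + actL A' (bd1 A' (s r)) (t e)
        + peiffer A' (s r) (f1 e) - peiffer A' (f1 e) (s r)
        - peiffer A' (s (bd1 A e)) (s r)))"

definition connects ::
  "('k, 'l::comm_ring, 'e::comm_ring, 'r::comm_ring) two_xmod \<Rightarrow>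
   ('k, 'l2::comm_ring, 'e2::comm_ring, 'r2::comm_ring) two_xmod \<Rightarrow>
   ('r \<Rightarrow> 'e2) \<Rightarrow> ('e \<Rightarrow> 'l2) \<Rightarrow>
   ('l, 'e, 'r, 'l2, 'e2, 'r2) xmap \<Rightarrow> ('l, 'e, 'r, 'l2, 'e2, 'r2) xmap \<Rightarrow> bool" where
  "connects A A' s t f g = (case f of (f2, f1, f0) \<Rightarrow> case g of (g2, g1, g0) \<Rightarrow>
     (\<forall>r. g0 r = f0 r + bd1 A' (s r)) \<and>
     (\<forall>e. g1 e = f1 e + s (bd1 A e) + bd2 A' (t e)) \<and>
     (\<forall>l. g2 l = f2 l + t (bd2 A l)))"

definition homotopy_rel ::
  "('k, 'l::comm_ring, 'e::comm_ring, 'r::comm_ring) two_xmod \<Rightarrow>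
   ('k, 'l2::comm_ring, 'e2::comm_ring, 'r2::comm_ring) two_xmod \<Rightarrow>
   (('l, 'e, 'r, 'l2, 'e2, 'r2) xmap \<times> ('l, 'e, 'r, 'l2, 'e2, 'r2) xmap) set" where
  "homotopy_rel A A' = {(f, g). f \<in> two_xmod_maps A A' \<and> g \<in> two_xmod_maps A A' \<and>
     (\<exists>s t. quadratic_derivation A A' f s t \<and> connects A A' s t f g)}"

end

theory Submission
  imports Defs
begin

text \<open>
  The zero derivation shows that \<open>f \<simeq> f\<close>. Given reflexivity, symmetry and transitivity both follow
  from the Euclidean property that \<open>f \<simeq> g\<close> and \<open>f \<simeq> h\<close> imply \<open>g \<simeq> h\<close>, so this single construction
  suffices.

  Let \<open>(a, p)\<close> connect \<open>f\<close> to \<open>g\<close> and let \<open>(c, q)\<close> connect \<open>f\<close> to \<open>h\<close>. In degree zero the obvious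
  candidate for a derivation from \<open>g\<close> to \<open>h\<close> is \<open>d = c - a\<close>, since \<open>h\<^sub>0 = g\<^sub>0 + \<partial>\<^sub>1 d\<close>. But it is not a
  \<open>g\<^sub>0\<close>-derivation: \<open>d (xy)\<close> contains \<open>a(x) d(y)\<close> in place of \<open>\<partial>\<^sub>1 a(x) \<triangleright> d(y)\<close>, and these differ by
  \<open>\<partial>\<^sub>2 {d(y), a(x)}\<close>. As the error lies in the image of \<open>\<partial>\<^sub>2\<close>, one looks for \<open>m : R \<rightarrow> L'\<close>
  such that \<open>b = d + \<partial>\<^sub>2 m\<close> is a \<open>g\<^sub>0\<close>-derivation. This dictates a product rule for \<open>m\<close>,
  namely the rule of a derivation twisted by the symmetric bilinear map
  \<open>\<beta>(x, y) = - {d(y), a(x)} - {d(x), a(y)}\<close>. Here freeness enters: the map \<open>m\<close> amounts to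
  an algebra map splitting the extension of \<open>R\<close> by \<open>L'\<close> with cocycle \<open>\<beta>\<close>
  (\<open>comm_algebra_on_extension\<close>), and such a splitting exists because values on free generators
  can be prescribed (\<open>ex_twisted_derivation\<close>). That \<open>\<beta>\<close> satisfies the associativity
  conditions is a consequence of the 2-crossed module axioms (\<open>ex_peiffer_correction\<close>).

  In degree one there is no further obstruction: \<open>h\<^sub>1 = g\<^sub>1 + b\<partial>\<^sub>1 + \<partial>\<^sub>2 y\<close> suggests
  \<open>y = q - p - m\<partial>\<^sub>1\<close>, and the rules for \<open>(b, y)\<close> are then a direct computation
  (\<open>quadratic_derivation_between\<close>).
\<close>

section \<open>Linear maps\<close>

lemma klinear_add: "klinear sA sB \<phi> \<Longrightarrow> \<phi> (x + y) = \<phi> x + \<phi> y"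
  and klinear_scale: "klinear sA sB \<phi> \<Longrightarrow> \<phi> (sA a x) = sB a (\<phi> x)"
  by (simp_all add: klinear_def)

lemma klinear_zero: "klinear sA sB \<phi> \<Longrightarrow> \<phi> 0 = 0"
  using klinear_add[of sA sB \<phi> 0 0] by simp

lemma klinear_minus: "klinear sA sB \<phi> \<Longrightarrow> \<phi> (- x) = - \<phi> x"
  using klinear_add[of sA sB \<phi> "- x" x] klinear_zero[of sA sB \<phi>]
  by (simp add: eq_neg_iff_add_eq_0)

lemma klinear_diff: "klinear sA sB \<phi> \<Longrightarrow> \<phi> (x - y) = \<phi> x - \<phi> y"
  using klinear_add[of sA sB \<phi> x "- y"] klinear_minus[of sA sB \<phi> y] by simp

context comm_algebra
begin

lemma scale_zero: "scale a 0 = 0"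
  using scale_right_distrib[of a 0 0] by simp

lemma scale_minus: "scale a (- x) = - scale a x"
  using scale_right_distrib[of a "- x" x] by (simp add: scale_zero eq_neg_iff_add_eq_0)

lemma scale_diff: "scale a (x - y) = scale a x - scale a y"
  using scale_right_distrib[of a x "- y"] by (simp add: scale_minus)

end

section \<open>Twisted derivations on a free algebra\<close>

text \<open>
  A map \<open>x \<mapsto> (x, D x)\<close> into this extension of \<open>R\<close> by \<open>M\<close> is multiplicative exactly when \<open>D\<close> is a
  derivation with the quadratic term \<open>D x * D y\<close>, twisted by \<open>\<beta>\<close>.
\<close>

definition extension_algebra ::
  "('k \<Rightarrow> 'r::comm_ring \<Rightarrow> 'r) \<Rightarrow> ('k \<Rightarrow> 'm::comm_ring \<Rightarrow> 'm) \<Rightarrow> ('r \<Rightarrow> 'm \<Rightarrow> 'm) \<Rightarrow>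
   ('r \<Rightarrow> 'r \<Rightarrow> 'm) \<Rightarrow> ('k, 'r \<times> 'm) alg_struct" where
  "extension_algebra sR sM act \<beta> =
     \<lparr>carr = UNIV,
      add = (\<lambda>(x, m) (y, n). (x + y, m + n)),
      zero = (0, 0),
      neg = (\<lambda>(x, m). (- x, - m)),
      mult = (\<lambda>(x, m) (y, n). (x * y, act x n + act y m + m * n + \<beta> x y)),
      smul = (\<lambda>a (x, m). (sR a x, sM a m))\<rparr>"

text \<open>
  Comparing the \<open>M\<close>-components of \<open>(u v) w\<close> and \<open>u (v w)\<close> yields two conditions: \<open>act_act\<close>
  balances the terms with one factor from \<open>M\<close> and those with one such factor multiplied by a value
  of \<open>\<beta>\<close>; \<open>cocycle\<close> balances the terms without a factor from \<open>M\<close>. So \<open>act\<close> is an action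
  only up to multiplication by \<open>\<beta>\<close>.
\<close>

lemma comm_algebra_on_extension:
  assumes R: "comm_algebra sR" and M: "comm_algebra sM"
    and act: "kbilinear sR sM sM act" and \<beta>: "kbilinear sR sR sM \<beta>"
    and act_mult: "\<And>x m n. act x (m * n) = act x m * n"
    and act_act: "\<And>x y m. act x (act y m) = act (x * y) m + \<beta> x y * m"
    and sym: "\<And>x y. \<beta> x y = \<beta> y x"
    and cocycle: "\<And>x y z. \<beta> (x * y) z + act z (\<beta> x y) = \<beta> x (y * z) + act x (\<beta> y z)"
  shows "comm_algebra_on (extension_algebra sR sM act \<beta>)"
proof -
  interpret R: comm_algebra sR by (rule R)
  interpret M: comm_algebra sM by (rule M)
  have lin: "klinear sM sM (act x)" "klinear sR sM (\<lambda>x. act x m)"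
    "klinear sR sM (\<beta> x)" "klinear sR sM (\<lambda>x. \<beta> x y)" for x y m
    using act \<beta> by (auto simp: kbilinear_def)
  note add = lin[THEN klinear_add] and scale = lin[THEN klinear_scale]
  have comm: "act x (act y m) = act y (act x m)" for x y m
    by (simp add: act_act sym[of x y] mult.commute[of x y])
  have assoc: "act (x * y) k + act z (act x n + act y m + m * n + \<beta> x y)
      + (act x n + act y m + m * n + \<beta> x y) * k + \<beta> (x * y) z =
    act x (act y k + act z n + n * k + \<beta> y z) + act (y * z) m
      + m * (act y k + act z n + n * k + \<beta> y z) + \<beta> x (y * z)" for x y z m n k
  proof -
    have "act z (act y m) = act (y * z) m + \<beta> y z * m"
      by (metis act_act comm)
    moreover have "act z (m * n) = m * act z n"
      by (metis act_mult mult.commute)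
    ultimately show ?thesis
      using cocycle[of x y z] act_act[of x y k] comm[of z x n] act_mult[of x n k]
        act_mult[of y m k] act_mult[of y k m]
      by (simp add: add algebra_simps)
  qed
  let ?X = "extension_algebra sR sM act \<beta>"
  have "mult ?X (mult ?X u v) w = mult ?X u (mult ?X v w)" for u v w
    using assoc by (auto simp: extension_algebra_def split_beta mult.assoc)
  then show ?thesis
    by unfold_locales
      (auto simp: extension_algebra_def split_beta R.scale_right_distrib R.scale_left_distrib
        R.scale_scale R.scale_one R.scale_mult M.scale_right_distrib M.scale_left_distrib
        M.scale_scale M.scale_one M.scale_mult add scale algebra_simps intro: sym)
qed

text \<open>
  The homomorphism from the free algebra \<open>R\<close> to the extension with \<open>b \<mapsto> (b, h b)\<close> on the generators
  is a section of the projection to \<open>R\<close>, because an endomorphism of \<open>R\<close> that fixes the generators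
  is the identity. Its second component is the required derivation.
\<close>

lemma ex_twisted_derivation:
  fixes h :: "'r::comm_ring \<Rightarrow> 'm::comm_ring"
  assumes R: "comm_algebra sR" and M: "comm_algebra sM"
    and free: "free_algebra_on sR B"
    and act: "kbilinear sR sM sM act" and \<beta>: "kbilinear sR sR sM \<beta>"
    and act_mult: "\<And>x m n. act x (m * n) = act x m * n"
    and act_act: "\<And>x y m. act x (act y m) = act (x * y) m + \<beta> x y * m"
    and sym: "\<And>x y. \<beta> x y = \<beta> y x"
    and cocycle: "\<And>x y z. \<beta> (x * y) z + act z (\<beta> x y) = \<beta> x (y * z) + act x (\<beta> y z)"
  shows "\<exists>D. klinear sR sM D \<and>
    (\<forall>x y. D (x * y) = act x (D y) + act y (D x) + D x * D y + \<beta> x y) \<and>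
    (\<forall>b\<in>B. D b = h b)"
proof -
  let ?X = "extension_algebra sR sM act \<beta>"
  have X: "comm_algebra_on ?X"
    using assms by (intro comm_algebra_on_extension)
  have "free_wrt TYPE('r \<times> 'm) sR B"
    using R free by (rule free_algebra_on_universal)
  moreover have "(\<lambda>b. (b, h b)) ` B \<subseteq> carr ?X"
    by (simp add: extension_algebra_def)
  ultimately obtain \<phi> where \<phi>: "algebra_map_into sR ?X \<phi>" and B: "\<forall>b\<in>B. \<phi> b = (b, h b)"
    using X unfolding free_wrt_def by (metis (no_types, lifting))
  have "free_wrt TYPE('r) sR B"
    using R free by (rule free_algebra_on_universal)
  moreover have "(\<lambda>b. b) ` B \<subseteq> carr (type_algebra sR)"
    by (simp add: type_algebra_def)
  ultimately have "\<exists>!\<psi>. algebra_map_into sR (type_algebra sR) \<psi> \<and> (\<forall>b\<in>B. \<psi> b = b)"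
    using R unfolding free_wrt_def comm_algebra_on_type_algebra[symmetric]
    by (metis (no_types, lifting))
  moreover have "algebra_map_into sR (type_algebra sR) (\<lambda>r. r)"
    by (simp add: algebra_map_into_def type_algebra_def)
  moreover have "algebra_map_into sR (type_algebra sR) (fst \<circ> \<phi>)"
    using \<phi> by (auto simp: algebra_map_into_def type_algebra_def extension_algebra_def split_beta)
  ultimately have "fst \<circ> \<phi> = (\<lambda>r. r)"
    using B by (metis comp_apply fst_conv)
  then have fst: "fst (\<phi> r) = r" for r
    by (metis comp_apply)
  have "klinear sR sM (snd \<circ> \<phi>)"
    using \<phi> by (simp add: algebra_map_into_def klinear_def extension_algebra_def split_beta)
  moreover have "(snd \<circ> \<phi>) (x * y) =
    act x ((snd \<circ> \<phi>) y) + act y ((snd \<circ> \<phi>) x) + (snd \<circ> \<phi>) x * (snd \<circ> \<phi>) y + \<beta> x y" for x y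
    using \<phi> by (simp add: algebra_map_into_def extension_algebra_def split_beta fst)
  ultimately show ?thesis
    using B by (intro exI[of _ "snd \<circ> \<phi>"]) simp
qed

section \<open>Calculation rules in a 2-crossed module\<close>

context two_crossed_module
begin

lemma actE_bilinear: "kbilinear (scaleR A) (scaleE A) (scaleE A) (actE A)"
  and actL_bilinear: "kbilinear (scaleR A) (scaleL A) (scaleL A) (actL A)"
  and actEL_bilinear: "kbilinear (scaleE A) (scaleL A) (scaleL A) (actEL A)"
  using actE_action actL_action actEL_action by (simp_all add: algebra_action_def)

lemmas structure_klinear =
  bd1_map[unfolded algebra_map_def, THEN conjunct1]
  bd2_map[unfolded algebra_map_def, THEN conjunct1]
  actE_bilinear[unfolded kbilinear_def, THEN conjunct1, rule_format]
  actE_bilinear[unfolded kbilinear_def, THEN conjunct2, rule_format]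
  actL_bilinear[unfolded kbilinear_def, THEN conjunct1, rule_format]
  actL_bilinear[unfolded kbilinear_def, THEN conjunct2, rule_format]
  actEL_bilinear[unfolded kbilinear_def, THEN conjunct1, rule_format]
  actEL_bilinear[unfolded kbilinear_def, THEN conjunct2, rule_format]
  peiffer_bilinear[unfolded kbilinear_def, THEN conjunct1, rule_format]
  peiffer_bilinear[unfolded kbilinear_def, THEN conjunct2, rule_format]

lemmas additive =
  structure_klinear[THEN klinear_add] structure_klinear[THEN klinear_diff]
  structure_klinear[THEN klinear_minus] structure_klinear[THEN klinear_zero]

lemmas homogeneous = structure_klinear[THEN klinear_scale]

lemma bd1_mult: "bd1 A (e * e') = bd1 A e * bd1 A e'"
  and bd2_mult: "bd2 A (l * l') = bd2 A l * bd2 A l'"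
  using bd1_map bd2_map by (simp_all add: algebra_map_def)

lemma actL_mult: "actL A r (l * l') = actL A r l * l'"
  and actL_comp: "actL A (r * r') l = actL A r (actL A r' l)"
  using actL_action unfolding algebra_action_def by blast+

lemma actL_left_commute: "actL A r (actL A r' l) = actL A r' (actL A r l)"
  by (metis actL_comp mult.commute)

lemma actEL_mult: "actEL A e (l * l') = actEL A e l * l'"
  and actEL_comp: "actEL A (e * e') l = actEL A e (actEL A e' l)"
  using actEL_action unfolding algebra_action_def by blast+

lemma actEL_left_commute: "actEL A e (actEL A e' l) = actEL A e' (actEL A e l)"
  by (metis actEL_comp mult.commute)

lemma peiffer_bd2: "peiffer A e (bd2 A l) = actEL A e l"
  by (simp add: actEL_def)

lemma actEL_bd2: "actEL A (bd2 A l) l' = l * l'"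
  by (simp add: actEL_def peiffer_bd2_bd2)

lemma actEL_actE: "actEL A (actE A r e) l = actL A r (actEL A e l)"
  by (simp add: actEL_def peiffer_equivariant(1))

lemma actEL_actL: "actEL A e (actL A r l) = actL A r (actEL A e l)"
  by (simp add: actEL_def bd2_act peiffer_equivariant(2))

text \<open>
  Expanding the right argument \<open>\<partial>\<^sub>2 {e', e''} = e' e'' - \<partial>\<^sub>1 e'' \<triangleright> e'\<close> and using the product rule of the
  lifting, the two terms in which \<open>\<partial>\<^sub>1 e''\<close> acts cancel.
\<close>

lemma actEL_peiffer: "actEL A e (peiffer A e' e'') = peiffer A (e * e') e''"
  using peiffer_mult[of e e' e'']
  by (simp add: actEL_def bd2_peiffer additive peiffer_equivariant(2))

section \<open>Difference of two quadratic derivations\<close>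

text \<open>
  The rule for \<open>d\<close> is the one satisfied by the difference \<open>c - a\<close> of two \<open>f\<close>-derivations, and the
  rule for \<open>m\<close> is the one that turns \<open>d + \<partial>\<^sub>2 m\<close> into a derivation over \<open>f + \<partial>\<^sub>1 a\<close>. The operator
  \<open>act\<close> below combines the action of \<open>f x + \<partial>\<^sub>1 a(x)\<close> with that of \<open>d(x)\<close>; it fails to be
  multiplicative in \<open>x\<close> by exactly the Peiffer elements that make up \<open>\<beta>\<close>.
\<close>

lemma ex_peiffer_correction:
  fixes f :: "'x::comm_ring \<Rightarrow> 'r"
  assumes X: "comm_algebra sX" and free: "free_algebra_on sX B"
    and f: "algebra_map sX (scaleR A) f"
    and a: "klinear sX (scaleE A) a" and d: "klinear sX (scaleE A) d"
    and a_mult: "\<And>x y. a (x * y) = actE A (f x) (a y) + actE A (f y) (a x) + a x * a y"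
    and d_mult: "\<And>x y. d (x * y) = actE A (f x) (d y) + actE A (f y) (d x)
      + a x * d y + a y * d x + d x * d y"
  shows "\<exists>m. klinear sX (scaleL A) m \<and>
    (\<forall>x y. m (x * y) = actL A (f x + bd1 A (a x)) (m y) + actL A (f y + bd1 A (a y)) (m x)
      + actEL A (d x) (m y) + actEL A (d y) (m x) + m x * m y
      - peiffer A (d y) (a x) - peiffer A (d x) (a y))"
proof -
  interpret L: comm_algebra "scaleL A" by (rule algebra_L)
  interpret E: comm_algebra "scaleE A" by (rule algebra_E)
  interpret R: comm_algebra "scaleR A" by (rule algebra_R)
  define act where "act x l = actL A (f x + bd1 A (a x)) l + actEL A (d x) l" for x l
  define \<beta> where "\<beta> x y = - peiffer A (d y) (a x) - peiffer A (d x) (a y)" for x y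
  have f_lin: "klinear sX (scaleR A) f" and f_mult: "f (x * y) = f x * f y" for x y
    using f by (simp_all add: algebra_map_def)
  note lin = f_lin[THEN klinear_add] a[THEN klinear_add] d[THEN klinear_add]
    f_lin[THEN klinear_scale] a[THEN klinear_scale] d[THEN klinear_scale]
  have act: "kbilinear sX (scaleL A) (scaleL A) act"
    by (simp add: kbilinear_def klinear_def act_def lin additive homogeneous
        L.scale_right_distrib)
  have \<beta>: "kbilinear sX sX (scaleL A) \<beta>"
    by (simp add: kbilinear_def klinear_def \<beta>_def lin additive homogeneous
        L.scale_diff L.scale_minus)
  have act_mult: "act x (m * n) = act x m * n" for x m n
    by (simp add: act_def actL_mult actEL_mult distrib_right)
  have act_act: "act x (act y l) = act (x * y) l + \<beta> x y * l" for x y l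
  proof -
    \<comment> \<open>Multiplication by \<open>{e, e'}\<close> in \<open>L\<close> is the action of its boundary, so it measures how far
      the action of \<open>e'\<close> is from that of \<open>\<partial>\<^sub>1 e'\<close>.\<close>
    have "peiffer A e e' * l = actEL A e (actEL A e' l) - actL A (bd1 A e') (actEL A e l)" for e e'
      using actEL_bd2[of "peiffer A e e'" l]
      by (simp add: bd2_peiffer additive actEL_comp actEL_actE)
    then show ?thesis
      by (simp add: act_def \<beta>_def a_mult d_mult f_mult additive bd1_act bd1_mult
          actL_comp actEL_comp actEL_actE actEL_actL left_diff_distrib distrib_right distrib_left)
        (simp add: algebra_simps actL_left_commute actEL_left_commute)
  qed
  have sym: "\<beta> x y = \<beta> y x" for x y
    by (simp add: \<beta>_def)
  have cocycle: "\<beta> (x * y) z + act z (\<beta> x y) = \<beta> x (y * z) + act x (\<beta> y z)" for x y z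
  proof -
    \<comment> \<open>Up to sign, the left-hand side is the sum of the cyclic permutations of \<open>T\<close>; hence it is
      invariant under cyclic permutation of \<open>x\<close>, \<open>y\<close>, \<open>z\<close>, which is the cocycle condition for a
      symmetric \<open>\<beta>\<close>. The Peiffer product rule is what restores the symmetry: it merges
      \<open>{d y * a x, a z} + \<partial>\<^sub>1 (a z) \<triangleright> {d y, a x}\<close> into \<open>{d y, a x * a z}\<close>.\<close>
    define T where "T x y z =
      actL A (f x) (peiffer A (d y) (a z) + peiffer A (d z) (a y))
      + peiffer A (d x) (a y * a z) + peiffer A (d x * d y) (a z)" for x y z
    have "\<beta> (x * y) z + act z (\<beta> x y) = - (T x y z + T y z x + T z x y)" for x y z
      using peiffer_mult[of "d y" "a x" "a z"] peiffer_mult[of "d x" "a y" "a z"]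
      by (simp add: T_def act_def \<beta>_def a_mult d_mult additive actEL_peiffer
          peiffer_equivariant[symmetric] mult.commute algebra_simps)
    from this[of x y z] this[of y z x] show ?thesis
      by (simp add: sym[of x "y * z"])
  qed
  obtain m where "klinear sX (scaleL A) m"
    and "\<And>x y. m (x * y) = act x (m y) + act y (m x) + m x * m y + \<beta> x y"
    using ex_twisted_derivation[OF X algebra_L free act \<beta> act_mult act_act sym cocycle] by blast
  then show ?thesis
    by (intro exI[of _ m]) (simp add: act_def \<beta>_def algebra_simps)
qed

text \<open>
  Here \<open>A\<close> is the target. The degree-zero part \<open>b\<close> of the new derivation is the difference \<open>c - a\<close>
  corrected by \<open>\<partial>\<^sub>2 m\<close>. Subtracting \<open>m \<partial>\<^sub>1\<close> in degree one compensates for this correction,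
  so that the pair still connects \<open>g\<close> to \<open>h\<close>.
\<close>

lemma quadratic_derivation_between:
  fixes S :: "('k, 'l2::comm_ring, 'e2::comm_ring, 'r2::comm_ring) two_xmod"
  assumes S: "two_crossed_module S" and free: "free_up_to_order_one S"
    and f: "f \<in> two_xmod_maps S A"
    and a: "quadratic_derivation S A f a p" "connects S A a p f g"
    and c: "quadratic_derivation S A f c q" "connects S A c q f h"
  shows "\<exists>b y. quadratic_derivation S A g b y \<and> connects S A b y g h"
proof -
  interpret S: two_crossed_module S by (rule S)
  interpret L: comm_algebra "scaleL A" by (rule algebra_L)
  interpret E: comm_algebra "scaleE A" by (rule algebra_E)
  obtain f2 f1 f0 where f_eq: "f = (f2, f1, f0)" by (cases f)
  obtain g2 g1 g0 where g_eq: "g = (g2, g1, g0)" by (cases g)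
  obtain h2 h1 h0 where h_eq: "h = (h2, h1, h0)" by (cases h)
  have f0: "algebra_map (scaleR S) (scaleR A) f0" and bd1_f: "\<And>e. bd1 A (f1 e) = f0 (bd1 S e)"
    using f by (simp_all add: f_eq two_xmod_maps_def)
  have f0_mult: "f0 (x * y) = f0 x * f0 y" for x y
    using f0 by (simp add: algebra_map_def)
  have lin: "klinear (scaleR S) (scaleE A) a" "klinear (scaleE S) (scaleL A) p"
      "klinear (scaleR S) (scaleE A) c" "klinear (scaleE S) (scaleL A) q"
    and a_mult: "\<And>x y. a (x * y) = actE A (f0 x) (a y) + actE A (f0 y) (a x) + a x * a y"
    and c_mult: "\<And>x y. c (x * y) = actE A (f0 x) (c y) + actE A (f0 y) (c x) + c x * c y"
    and p_mult: "\<And>e e'. p (e * e') =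
        peiffer A (a (bd1 S e)) (f1 e') + peiffer A (a (bd1 S e')) (f1 e)
        + actEL A (f1 e) (p e') + actEL A (f1 e') (p e)
        + actEL A (a (bd1 S e)) (p e') + actEL A (a (bd1 S e')) (p e) + p e * p e'"
    and q_mult: "\<And>e e'. q (e * e') =
        peiffer A (c (bd1 S e)) (f1 e') + peiffer A (c (bd1 S e')) (f1 e)
        + actEL A (f1 e) (q e') + actEL A (f1 e') (q e)
        + actEL A (c (bd1 S e)) (q e') + actEL A (c (bd1 S e')) (q e) + q e * q e'"
    and p_act: "\<And>r e. p (actE S r e) =
        actL A (f0 r) (p e) + actL A (bd1 A (a r)) (p e)
        + peiffer A (a r) (f1 e) - peiffer A (f1 e) (a r) - peiffer A (a (bd1 S e)) (a r)"
    and q_act: "\<And>r e. q (actE S r e) =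
        actL A (f0 r) (q e) + actL A (bd1 A (c r)) (q e)
        + peiffer A (c r) (f1 e) - peiffer A (f1 e) (c r) - peiffer A (c (bd1 S e)) (c r)"
    using a(1) c(1) by (simp_all add: f_eq quadratic_derivation_def)
  have g: "g0 r = f0 r + bd1 A (a r)" "g1 e = f1 e + a (bd1 S e) + bd2 A (p e)"
      "g2 l = f2 l + p (bd2 S l)"
    and h: "h0 r = f0 r + bd1 A (c r)" "h1 e = f1 e + c (bd1 S e) + bd2 A (q e)"
      "h2 l = f2 l + q (bd2 S l)" for r e l
    using a(2) c(2) by (simp_all add: f_eq g_eq h_eq connects_def)
  \<comment> \<open>All terms are expressed through \<open>a\<close> and \<open>d\<close>, since the rule for \<open>m\<close> is stated in terms of
    these; \<open>c\<close> is eliminated by \<open>c_eq\<close>.\<close>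
  note lin_simps = lin[THEN klinear_add] lin[THEN klinear_scale] S.additive S.homogeneous
  define d where "d r = c r - a r" for r
  have c_eq: "c r = a r + d r" for r
    by (simp add: d_def)
  have d_lin: "klinear (scaleR S) (scaleE A) d"
    by (simp add: klinear_def d_def lin_simps E.scale_diff)
  have d_mult: "d (x * y) = actE A (f0 x) (d y) + actE A (f0 y) (d x)
      + a x * d y + a y * d x + d x * d y" for x y
    by (simp add: d_def a_mult c_mult additive algebra_simps)
  obtain B where "free_algebra_on (scaleR S) B"
    using free by (auto simp: free_up_to_order_one_def)
  then obtain m where m_lin: "klinear (scaleR S) (scaleL A) m"
    and m_mult: "\<And>x y. m (x * y) =
      actL A (f0 x + bd1 A (a x)) (m y) + actL A (f0 y + bd1 A (a y)) (m x)
      + actEL A (d x) (m y) + actEL A (d y) (m x) + m x * m y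
      - peiffer A (d y) (a x) - peiffer A (d x) (a y)"
    using ex_peiffer_correction[OF S.algebra_R _ f0 lin(1) d_lin a_mult d_mult] by blast
  define b where "b r = d r + bd2 A (m r)" for r
  define y where "y e = q e - p e - m (bd1 S e)" for e
  note m_simps = m_lin[THEN klinear_add] m_lin[THEN klinear_scale] m_lin[THEN klinear_zero]
  have b_lin: "klinear (scaleR S) (scaleE A) b"
    by (simp add: klinear_def b_def m_simps d_lin[THEN klinear_add] d_lin[THEN klinear_scale]
        additive homogeneous E.scale_right_distrib)
  have y_lin: "klinear (scaleE S) (scaleL A) y"
    by (simp add: klinear_def y_def lin_simps m_simps L.scale_diff)
  have b_mult: "b (u * v) = actE A (g0 u) (b v) + actE A (g0 v) (b u) + b u * b v" for u v
  proof -
    have *: "bd2 A (actEL A e l) = e * bd2 A l" for e l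
      by (simp add: actEL_def bd2_peiffer bd1_bd2 additive)
    show ?thesis
      by (simp add: b_def d_mult m_mult g additive bd2_mult bd2_act bd2_peiffer * algebra_simps)
  qed
  have y_mult: "y (e * e') =
      peiffer A (b (bd1 S e)) (g1 e') + peiffer A (b (bd1 S e')) (g1 e)
      + actEL A (g1 e) (y e') + actEL A (g1 e') (y e)
      + actEL A (b (bd1 S e)) (y e') + actEL A (b (bd1 S e')) (y e) + y e * y e'" for e e'
    by (simp add: y_def p_mult q_mult b_def g c_eq S.bd1_mult m_mult additive bd1_f
        actEL_bd2 peiffer_bd2 peiffer_bd2_left algebra_simps)
  have y_act: "y (actE S r e) =
      actL A (g0 r) (y e) + actL A (bd1 A (b r)) (y e)
      + peiffer A (b r) (g1 e) - peiffer A (g1 e) (b r) - peiffer A (b (bd1 S e)) (b r)" for r e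
    by (simp add: y_def p_act q_act b_def g c_eq S.bd1_act m_mult additive bd1_f bd1_bd2
        actEL_bd2 peiffer_bd2 peiffer_bd2_left algebra_simps)
  have "quadratic_derivation S A g b y"
    using b_lin y_lin b_mult y_mult y_act by (simp add: g_eq quadratic_derivation_def)
  moreover have "connects S A b y g h"
    by (simp add: g_eq h_eq connects_def g h b_def y_def c_eq additive bd1_bd2 S.bd1_bd2 m_simps)
  ultimately show ?thesis by blast
qed

lemma quadratic_derivation_zero:
  "quadratic_derivation S A f (\<lambda>_. 0) (\<lambda>_. 0)" "connects S A (\<lambda>_. 0) (\<lambda>_. 0) f f"
proof -
  interpret L: comm_algebra "scaleL A" by (rule algebra_L)
  interpret E: comm_algebra "scaleE A" by (rule algebra_E)
  show "quadratic_derivation S A f (\<lambda>_. 0) (\<lambda>_. 0)" "connects S A (\<lambda>_. 0) (\<lambda>_. 0) f f"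
    by (auto simp: quadratic_derivation_def connects_def klinear_def additive
        L.scale_zero E.scale_zero)
qed

end

theorem theorem4p25:
  fixes A :: "('k::{comm_ring,comm_monoid_mult}, 'l::comm_ring, 'e::comm_ring, 'r::comm_ring) two_xmod"
    and A' :: "('k, 'l2::comm_ring, 'e2::comm_ring, 'r2::comm_ring) two_xmod"
  assumes "two_crossed_module A" and "two_crossed_module A'"
    and "free_up_to_order_one A"
  shows "equiv (two_xmod_maps A A') (homotopy_rel A A')"
proof -
  interpret A': two_crossed_module A' by (rule assms(2))
  let ?H = "homotopy_rel A A'"
  have carrier: "?H \<subseteq> two_xmod_maps A A' \<times> two_xmod_maps A A'"
    by (auto simp: homotopy_rel_def)
  have refl: "(f, f) \<in> ?H" if "f \<in> two_xmod_maps A A'" for f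
    using that A'.quadratic_derivation_zero[of A f] unfolding homotopy_rel_def by blast
  have euclidean: "(g, h) \<in> ?H" if "(f, g) \<in> ?H" "(f, h) \<in> ?H" for f g h
  proof -
    from that have maps: "f \<in> two_xmod_maps A A'" "g \<in> two_xmod_maps A A'" "h \<in> two_xmod_maps A A'"
      using carrier by auto
    obtain a p c q where "quadratic_derivation A A' f a p" "connects A A' a p f g"
      "quadratic_derivation A A' f c q" "connects A A' c q f h"
      using \<open>(f, g) \<in> ?H\<close> \<open>(f, h) \<in> ?H\<close> by (auto simp: homotopy_rel_def)
    from A'.quadratic_derivation_between[OF assms(1,3) maps(1) this]
    show ?thesis
      using maps by (auto simp: homotopy_rel_def)
  qed
  have sym: "(g, f) \<in> ?H" if "(f, g) \<in> ?H" for f g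
    using that carrier by (intro euclidean[OF that] refl) auto
  show ?thesis
  proof (rule equivI)
    show "?H \<subseteq> two_xmod_maps A A' \<times> two_xmod_maps A A'" by (rule carrier)
    show "refl_on (two_xmod_maps A A') ?H" using refl by (intro refl_onI)
    show "sym ?H" using sym by (rule symI)
    show "trans ?H" using sym euclidean by (blast intro: transI)
  qed
qed

end
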